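(* Let $E$ be a vector space over a field $K$. If computability is stable over the field $\langle K,+,\times\rangle$ and the vector space $\langle K,E,+,\times,+,.\rangle$ is finite-dimensional, then computability is stable over $\langle K,E,+,\times,+,.\rangle$.
   Context: Computability over natural numbers is the usual one. A set $A \subseteq \mathbb{N}$ is effectively enumerable if it is empty or the image of a total computable function from $\mathbb{N}$ to $\mathbb{N}$. For $A \subseteq \mathbb{N}^m$ and $B \subseteq \mathbb{N}$, a computable function from $A$ to $B$ is a partial computable function that is defined at every element of $A$ and takes values in $B$ there. Indexing: an indexing of a set $E$ is a partial function $i$ from $\mathbb{N}$ to $E$ such that $dom(i)$ is effectively enumerable, $i$ is surjective, and there is a computable function $eq$ from $dom(i)\times dom(i)$ to $\{0,1\}$ with $eq(x,y)=1$ if $i(x)=i(y)$ and $eq(x,y)=0$ otherwise. An indexing of a family of sets $E_1,\ldots,E_n$ is a family $i_1,\ldots,i_n$ of indexings of $E_1,\ldots,E_n$. Computable function: given sets $E_1,\ldots,E_m,E_{m+1}$ with indexings $i_1,\ldots,i_{m+1}$, a function $f: E_1\times\ldots\times E_m \to E_{m+1}$ is computable relatively to this indexing if there is a computable function $\hat f$ from $dom(i_1)\times\ldots\times dom(i_m)$ to $dom(i_{m+1})$ such that $i_{m+1}(\hat f(x_1,\ldots,x_m)) = f(i_1(x_1),\ldots,i_m(x_m))$ for all $x_k \in dom(i_k)$. Admissible indexing: a structure $\langle E_1,\ldots,E_n,op_1,\ldots,op_p\rangle$ consists of sets $E_1,\ldots,E_n$ and operations, each from a product of some of these sets to one of these sets.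 An indexing of it is an indexing of $E_1,\ldots,E_n$; it is admissible if every $op_k$ is computable relatively to the indexings of its domains and co-domain. Stable computability: computability is stable over $\langle E_1,\ldots,E_n,op_1,\ldots,op_p\rangle$ if there exists an admissible indexing of this structure and, for all admissible indexings $j_1,\ldots,j_n$ and $j'_1,\ldots,j'_n$ of it, there exist computable functions $h_k$ from $dom(j'_k)$ to $dom(j_k)$ such that $j'_k = j_k\circ h_k$, for $k=1,\ldots,n$. A vector space $E$ over a field $K$ is viewed as the two-sorted structure $\langle K,E,+,\times,+,.\rangle$, with the addition and multiplication of $K$, the addition of $E$ and the multiplication of a vector by a scalar. *)

theory Defs
  imports Complex_Main
begin

text \<open>Partial functions of several natural numbers are maps on argument lists. In
  \<open>partial_recursive n f\<close> only the values of \<open>f\<close> at lists of length \<open>n\<close> are relevant.\<close>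

definition comp_fun ::
  "(nat list \<Rightarrow> nat option) \<Rightarrow> (nat list \<Rightarrow> nat option) list \<Rightarrow> nat list \<Rightarrow> nat option" where
  "comp_fun f gs xs =
     (if \<forall>g\<in>set gs. g xs \<noteq> None then f (map (\<lambda>g. the (g xs)) gs) else None)"

definition prim_rec_fun ::
  "(nat list \<Rightarrow> nat option) \<Rightarrow> (nat list \<Rightarrow> nat option) \<Rightarrow> nat list \<Rightarrow> nat option" where
  "prim_rec_fun f g xs =
     rec_nat (f (tl xs)) (\<lambda>k r. Option.bind r (\<lambda>v. g (k # v # tl xs))) (hd xs)"

definition mu_fun :: "(nat list \<Rightarrow> nat option) \<Rightarrow> nat list \<Rightarrow> nat option" where
  "mu_fun f xs =
     (if \<exists>z. f (z # xs) = Some 0 \<and> (\<forall>y<z. f (y # xs) \<noteq> None)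
      then Some (LEAST z. f (z # xs) = Some 0) else None)"

inductive partial_recursive :: "nat \<Rightarrow> (nat list \<Rightarrow> nat option) \<Rightarrow> bool" where
  zero: "partial_recursive n (\<lambda>xs. Some 0)"
| succ: "partial_recursive 1 (\<lambda>xs. Some (Suc (hd xs)))"
| proj: "k < n \<Longrightarrow> partial_recursive n (\<lambda>xs. Some (xs ! k))"
| comp: "partial_recursive (length gs) f \<Longrightarrow> \<forall>g\<in>set gs. partial_recursive n g \<Longrightarrow>
           partial_recursive n (comp_fun f gs)"
| prim_rec: "partial_recursive n f \<Longrightarrow> partial_recursive (Suc (Suc n)) g \<Longrightarrow>
           partial_recursive (Suc n) (prim_rec_fun f g)"
| mu: "partial_recursive (Suc n) f \<Longrightarrow> partial_recursive n (mu_fun f)"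

text \<open>Here \<open>A\<close> is meant to consist of lists of length \<open>m\<close>; the function may be defined
  outside \<open>A\<close>.\<close>

definition computable_from_to ::
  "nat \<Rightarrow> nat list set \<Rightarrow> nat set \<Rightarrow> (nat list \<Rightarrow> nat option) \<Rightarrow> bool" where
  "computable_from_to m A B f \<longleftrightarrow>
     partial_recursive m f \<and> (\<forall>xs\<in>A. \<exists>y\<in>B. f xs = Some y)"

definition effectively_enumerable :: "nat set \<Rightarrow> bool" where
  "effectively_enumerable A \<longleftrightarrow>
     A = {} \<or>
     (\<exists>f. partial_recursive 1 f \<and> (\<forall>x. f [x] \<noteq> None) \<and> A = range (\<lambda>x. the (f [x])))"

definition indexing :: "'u set \<Rightarrow> (nat \<Rightarrow> 'u option) \<Rightarrow> bool" where
  "indexing E i \<longleftrightarrow>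
     ran i = E \<and> effectively_enumerable (dom i) \<and>
     (\<exists>e. computable_from_to 2 (listset [dom i, dom i]) {0, 1} e \<and>
        (\<forall>x\<in>dom i. \<forall>y\<in>dom i. e [x, y] = Some (if i x = i y then 1 else 0)))"

definition computable_rel ::
  "(nat \<Rightarrow> 'u option) list \<Rightarrow> (nat \<Rightarrow> 'u option) \<Rightarrow> ('u list \<Rightarrow> 'u) \<Rightarrow> bool" where
  "computable_rel is j f \<longleftrightarrow>
     (\<exists>fh. computable_from_to (length is) (listset (map dom is)) (dom j) fh \<and>
        (\<forall>xs\<in>listset (map dom is).
           (j \<circ>\<^sub>m fh) xs = Some (f (map2 (\<lambda>i x. the (i x)) is xs))))"

text \<open>The sorts of a structure are subsets of one common type and are referred to by their
  positions (from 0) in the list of sorts. Only the values of an operation at arguments of the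
  right sorts are relevant.\<close>

datatype 'u operation =
  Operation (arg_sorts: "nat list") (res_sort: nat) (op_fun: "'u list \<Rightarrow> 'u")

datatype 'u many_sorted =
  Many_Sorted (sorts: "'u set list") (operations: "'u operation list")

definition wf_many_sorted :: "'u many_sorted \<Rightarrow> bool" where
  "wf_many_sorted S \<longleftrightarrow>
     (\<forall>p\<in>set (operations S).
        set (arg_sorts p) \<subseteq> {..<length (sorts S)} \<and> res_sort p < length (sorts S) \<and>
        (\<forall>us\<in>listset (map (\<lambda>k. sorts S ! k) (arg_sorts p)).
           op_fun p us \<in> sorts S ! res_sort p))"

definition admissible_indexing :: "'u many_sorted \<Rightarrow> (nat \<Rightarrow> 'u option) list \<Rightarrow> bool" where
  "admissible_indexing S is \<longleftrightarrow>
     list_all2 indexing (sorts S) is \<and>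
     (\<forall>p\<in>set (operations S).
        computable_rel (map (\<lambda>k. is ! k) (arg_sorts p)) (is ! res_sort p) (op_fun p))"

definition computability_stable :: "'u many_sorted \<Rightarrow> bool" where
  "computability_stable S \<longleftrightarrow>
     (\<exists>is. admissible_indexing S is) \<and>
     (\<forall>js js'. admissible_indexing S js \<longrightarrow> admissible_indexing S js' \<longrightarrow>
        (\<forall>k<length (sorts S). \<exists>h.
           computable_from_to 1 (listset [dom (js' ! k)]) (dom (js ! k)) h \<and>
           (\<forall>x\<in>dom (js' ! k). (js' ! k) x = ((js ! k) \<circ>\<^sub>m h) [x])))"

definition field_structure :: "'k::field many_sorted" where
  "field_structure = Many_Sorted [UNIV]
     [Operation [0, 0] 0 (\<lambda>us. us ! 0 + us ! 1),
      Operation [0, 0] 0 (\<lambda>us. us ! 0 * us ! 1)]"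

text \<open>Scalars and vectors are put into one type as the two summands of \<open>'k + 'e\<close>.\<close>

definition vector_space_structure ::
  "('k::field \<Rightarrow> 'e::ab_group_add \<Rightarrow> 'e) \<Rightarrow> ('k + 'e) many_sorted" where
  "vector_space_structure scale = Many_Sorted [range Inl, range Inr]
     [Operation [0, 0] 0 (\<lambda>us. Inl (projl (us ! 0) + projl (us ! 1))),
      Operation [0, 0] 0 (\<lambda>us. Inl (projl (us ! 0) * projl (us ! 1))),
      Operation [1, 1] 1 (\<lambda>us. Inr (projr (us ! 0) + projr (us ! 1))),
      Operation [0, 1] 1 (\<lambda>us. Inr (scale (projl (us ! 0)) (projr (us ! 1))))]"

lemma wf_field_structure: "wf_many_sorted field_structure"
  by (simp add: wf_many_sorted_def field_structure_def)

lemma wf_vector_space_structure: "wf_many_sorted (vector_space_structure scale)"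
  by (simp add: wf_many_sorted_def vector_space_structure_def)

end

theory Submission
  imports Defs
begin

text \<open>Fix a sequence \<open>\<gamma>\<close> running through \<open>K\<close> and a basis \<open>b\<^sub>1, \<dots>, b\<^sub>n\<close>. Decoding \<open>z\<close> into an
  \<open>n\<close>-tuple and forming \<open>\<gamma> z\<^sub>1 . b\<^sub>1 + \<dots> + \<gamma> z\<^sub>n . b\<^sub>n\<close> enumerates \<open>E\<close>. Taken as an indexing of \<open>E\<close>, this
  enumeration is admissible, because equality and the operations are computed coordinatewise.
  Conversely, it is computable in every admissible indexing: the indices of the basis vectors are
  finitely many constants, and the indices of the scalars \<open>\<gamma> m\<close> can be translated from one
  indexing to another by stability over \<open>K\<close>. Hence an index of a vector is translated by searching,
  with the computable equality of its own indexing, for its place in the common enumeration.\<close>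

section \<open>Recursive functions on restricted domains\<close>

declare listset.simps [simp del]

text \<open>The values are those of a total HOL function, so compositions carry no
  \<open>option\<close>; outside \<open>A\<close>, where arguments need not be indices,
  \<open>p\<close> may diverge or take any value.\<close>

definition recursive_on :: "nat \<Rightarrow> nat list set \<Rightarrow> (nat list \<Rightarrow> nat) \<Rightarrow> bool" where
  "recursive_on n A f \<longleftrightarrow> (\<exists>p. partial_recursive n p \<and> (\<forall>xs\<in>A. p xs = Some (f xs)))"

abbreviation recursive1 :: "nat set \<Rightarrow> (nat \<Rightarrow> nat) \<Rightarrow> bool" where
  "recursive1 A F \<equiv> recursive_on (Suc 0) (listset [A]) (\<lambda>xs. F (xs ! 0))"

abbreviation recursive2 :: "nat set \<Rightarrow> nat set \<Rightarrow> (nat \<Rightarrow> nat \<Rightarrow> nat) \<Rightarrow> bool" where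
  "recursive2 A B F \<equiv> recursive_on 2 (listset [A, B]) (\<lambda>xs. F (xs ! 0) (xs ! Suc 0))"

lemma listset1: "listset [A] = {[x] |x. x \<in> A}"
  by (auto simp: listset.simps set_Cons_def)

lemma listset2: "listset [A, B] = {[x, y] |x y. x \<in> A \<and> y \<in> B}"
  by (auto simp: listset.simps set_Cons_def)

lemma listset3: "listset [A, B, C] = {[x, y, z] |x y z. x \<in> A \<and> y \<in> B \<and> z \<in> C}"
  by (auto simp: listset.simps set_Cons_def)

lemma recursive_on_cong:
  assumes "recursive_on n A f" "\<And>xs. xs \<in> A \<Longrightarrow> f xs = g xs"
  shows "recursive_on n A g"
  using assms unfolding recursive_on_def by auto

lemma recursive_on_proj: "k < n \<Longrightarrow> recursive_on n A (\<lambda>xs. xs ! k)"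
  unfolding recursive_on_def using partial_recursive.proj by blast

lemma recursive_on_comp:
  assumes f: "recursive_on (length gs) B f"
    and gs: "\<And>g. g \<in> set gs \<Longrightarrow> recursive_on n A g"
    and B: "\<And>xs. xs \<in> A \<Longrightarrow> map (\<lambda>g. g xs) gs \<in> B"
  shows "recursive_on n A (\<lambda>xs. f (map (\<lambda>g. g xs) gs))"
proof -
  obtain p where p: "partial_recursive (length gs) p" "\<And>xs. xs \<in> B \<Longrightarrow> p xs = Some (f xs)"
    using f unfolding recursive_on_def by blast
  \<comment> \<open>A program is chosen for each function \<open>g\<close> rather than for each
    position, so that \<open>map q gs\<close> is the list of programs.\<close>
  have "\<forall>g\<in>set gs. \<exists>q. partial_recursive n q \<and> (\<forall>xs\<in>A. q xs = Some (g xs))"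
    using gs unfolding recursive_on_def by blast
  then obtain q where q: "\<And>g. g \<in> set gs \<Longrightarrow> partial_recursive n (q g)"
      "\<And>g xs. g \<in> set gs \<Longrightarrow> xs \<in> A \<Longrightarrow> q g xs = Some (g xs)"
    by metis
  have "partial_recursive n (comp_fun p (map q gs))"
    using p(1) q(1) by (intro partial_recursive.comp) auto
  moreover have "comp_fun p (map q gs) xs = Some (f (map (\<lambda>g. g xs) gs))" if "xs \<in> A" for xs
  proof -
    have *: "map (\<lambda>g. the (g xs)) (map q gs) = map (\<lambda>g. g xs) gs"
      using q(2) that by simp
    show ?thesis
      unfolding comp_fun_def * using q(2) p(2) B that by simp
  qed
  ultimately show ?thesis unfolding recursive_on_def by blast
qed

lemma recursive1_comp:
  assumes "recursive1 B F" "recursive_on n A g" "\<And>xs. xs \<in> A \<Longrightarrow> g xs \<in> B"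
  shows "recursive_on n A (\<lambda>xs. F (g xs))"
proof -
  have "recursive_on n A (\<lambda>xs. (\<lambda>xs. F (xs ! 0)) (map (\<lambda>g. g xs) [g]))"
    by (rule recursive_on_comp[where B = "listset [B]"]) (use assms in \<open>auto simp: listset1\<close>)
  then show ?thesis by simp
qed

lemma recursive2_comp:
  assumes "recursive2 B C F" "recursive_on n A g" "recursive_on n A h"
    and "\<And>xs. xs \<in> A \<Longrightarrow> g xs \<in> B" "\<And>xs. xs \<in> A \<Longrightarrow> h xs \<in> C"
  shows "recursive_on n A (\<lambda>xs. F (g xs) (h xs))"
proof -
  have "recursive_on n A (\<lambda>xs. (\<lambda>xs. F (xs ! 0) (xs ! Suc 0)) (map (\<lambda>g. g xs) [g, h]))"
    by (rule recursive_on_comp[where B = "listset [B, C]"])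
      (use assms in \<open>auto simp: listset2 numeral_2_eq_2\<close>)
  then show ?thesis by simp
qed

section \<open>Closure under arithmetic and unbounded search\<close>

lemma recursive1_Suc: "recursive1 UNIV Suc"
  unfolding recursive_on_def using partial_recursive.succ by (force simp: listset1)

lemma recursive_on_const: "recursive_on n A (\<lambda>xs. c)"
proof (induction c)
  case 0
  show ?case unfolding recursive_on_def using partial_recursive.zero by blast
next
  case (Suc c)
  from recursive1_comp[OF recursive1_Suc Suc] show ?case by simp
qed

lemma recursive_on_Suc: "recursive_on n A g \<Longrightarrow> recursive_on n A (\<lambda>xs. Suc (g xs))"
  by (rule recursive1_comp[OF recursive1_Suc]) auto

text \<open>Recursion on the first argument with a single parameter \<open>y\<close>, the shape of
  all the arithmetic below; \<open>H\<close> takes its arguments in the order used by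
  \<open>prim_rec_fun\<close>.\<close>

lemma recursive2_prim_rec:
  assumes G: "recursive1 UNIV G"
    and H: "recursive_on 3 (listset [UNIV, UNIV, UNIV]) (\<lambda>xs. H (xs ! 0) (xs ! Suc 0) (xs ! 2))"
    and F0: "\<And>y. F 0 y = G y" and FSuc: "\<And>k y. F (Suc k) y = H k (F k y) y"
  shows "recursive2 UNIV UNIV F"
proof -
  obtain p where p: "partial_recursive 1 p" "\<And>y. p [y] = Some (G y)"
    using G unfolding recursive_on_def listset1 by auto
  obtain q where q: "partial_recursive 3 q" "\<And>k r y. q [k, r, y] = Some (H k r y)"
    using H unfolding recursive_on_def listset3 by auto
  have "partial_recursive 2 (prim_rec_fun p q)"
    using partial_recursive.prim_rec[of 1 p q] p(1) q(1)
    by (simp add: numeral_2_eq_2 numeral_3_eq_3)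
  moreover have "prim_rec_fun p q [k, y] = Some (F k y)" for k y
    by (induction k) (simp_all add: prim_rec_fun_def p(2) q(2) F0 FSuc)
  ultimately show ?thesis unfolding recursive_on_def listset2 by auto
qed

lemma recursive_on_add:
  assumes "recursive_on n A f" "recursive_on n A g"
  shows "recursive_on n A (\<lambda>xs. f xs + g xs)"
proof -
  have "recursive2 UNIV UNIV (+)"
    by (rule recursive2_prim_rec[where G = "\<lambda>y. y" and H = "\<lambda>k r y. Suc r"])
      (auto intro!: recursive_on_Suc recursive_on_proj)
  from recursive2_comp[OF this assms] show ?thesis by simp
qed

lemma recursive_on_mult:
  assumes "recursive_on n A f" "recursive_on n A g"
  shows "recursive_on n A (\<lambda>xs. f xs * g xs)"
proof -
  have "recursive2 UNIV UNIV (*)"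
    by (rule recursive2_prim_rec[where G = "\<lambda>y. 0" and H = "\<lambda>k r y. y + r"])
      (auto intro!: recursive_on_const recursive_on_add recursive_on_proj)
  from recursive2_comp[OF this assms] show ?thesis by simp
qed

lemma recursive_on_diff:
  assumes "recursive_on n A f" "recursive_on n A g"
  shows "recursive_on n A (\<lambda>xs. f xs - g xs)"
proof -
  \<comment> \<open>The predecessor: the recursion step returns the counter \<open>k\<close> and
    discards the previous value; \<open>y\<close> is a dummy parameter.\<close>
  have "recursive2 UNIV UNIV (\<lambda>k y. k - 1)"
    by (rule recursive2_prim_rec[where G = "\<lambda>y. 0" and H = "\<lambda>k r y. k"])
      (auto intro!: recursive_on_const recursive_on_proj)
  from recursive2_comp[OF this]
  have pred: "recursive_on m B (\<lambda>xs. h xs - 1)" if "recursive_on m B h" for m B h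
    using that by blast
  \<comment> \<open>The recursion runs over the number subtracted, hence the swapped arguments here
    and in \<open>assms(2,1)\<close>.\<close>
  have "recursive2 UNIV UNIV (\<lambda>k y. y - k)"
    by (rule recursive2_prim_rec[where G = "\<lambda>y. y" and H = "\<lambda>k r y. r - 1"])
      (auto intro!: pred[simplified] recursive_on_proj)
  from recursive2_comp[OF this assms(2,1)] show ?thesis by simp
qed

text \<open>Since \<open>f\<close> has a value at every \<open>z # xs\<close> with \<open>xs\<close>
  in \<open>A\<close>, the demand of \<open>mu_fun\<close> that all earlier values be defined is
  met, and the search stops at the least zero.\<close>

lemma recursive_on_Least:
  assumes f: "recursive_on (Suc n) (set_Cons UNIV A) f"
    and ex: "\<And>xs. xs \<in> A \<Longrightarrow> \<exists>z. f (z # xs) = 0"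
  shows "recursive_on n A (\<lambda>xs. LEAST z. f (z # xs) = 0)"
proof -
  obtain p where p: "partial_recursive (Suc n) p"
      "\<And>z xs. xs \<in> A \<Longrightarrow> p (z # xs) = Some (f (z # xs))"
    using f unfolding recursive_on_def set_Cons_def by blast
  have "mu_fun p xs = Some (LEAST z. f (z # xs) = 0)" if "xs \<in> A" for xs
    using ex[OF that] p(2)[OF that] by (simp add: mu_fun_def)
  then show ?thesis
    unfolding recursive_on_def using partial_recursive.mu[OF p(1)] by blast
qed

lemma recursive1_Least:
  assumes "recursive2 UNIV A f" "\<And>x. x \<in> A \<Longrightarrow> \<exists>z. f z x = 0"
  shows "recursive1 A (\<lambda>x. LEAST z. f z x = 0)"
proof -
  have "recursive_on (Suc 0) (listset [A]) (\<lambda>xs. LEAST z. (\<lambda>xs. f (xs ! 0) (xs ! Suc 0)) (z # xs) = 0)"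
    by (rule recursive_on_Least)
      (use assms in \<open>auto simp: listset.simps set_Cons_def numeral_2_eq_2\<close>)
  then show ?thesis by simp
qed

text \<open>Search for the least preimage. It will turn an index of a scalar into its place in an
  enumeration of all indices.\<close>

lemma recursive1_right_inverse:
  assumes f: "recursive1 UNIV f" and A: "A \<subseteq> range f"
  obtains g where "recursive1 A g" "\<forall>x\<in>A. f (g x) = x"
proof -
  \<comment> \<open>With truncated subtraction this is the distance of \<open>f z\<close> and
    \<open>x\<close>, so its zeros are the preimages of \<open>x\<close>.\<close>
  let ?d = "\<lambda>z x. (f z - x) + (x - f z)"
  let ?g = "\<lambda>x. LEAST z. ?d z x = 0"
  have ex: "\<exists>z. ?d z x = 0" if "x \<in> A" for x
    using A that by force
  have "recursive2 UNIV A ?d"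
    by (intro recursive_on_add recursive_on_diff recursive1_comp[OF f] recursive_on_proj) auto
  then have "recursive1 A ?g"
    using ex by (rule recursive1_Least)
  moreover have "f (?g x) = x" if "x \<in> A" for x
    using LeastI_ex[OF ex[OF that]] by simp
  ultimately show thesis by (intro that[of ?g] ballI)
qed

section \<open>Pairing\<close>

text \<open>The pair \<open>(a, b)\<close> is coded by \<open>(a + b)\<^sup>2 + a\<close>, whose integer square root is \<open>a + b\<close>.\<close>

definition pair_code :: "nat \<Rightarrow> nat \<Rightarrow> nat" where
  "pair_code a b = (a + b) * (a + b) + a"

text \<open>The difference vanishes iff z < (s + 1)^2, so the least such \<open>s\<close> is the
  floor of the square root; this form suits the search for a zero.\<close>

definition isqrt :: "nat \<Rightarrow> nat" where
  "isqrt z = (LEAST s. Suc z - Suc s * Suc s = 0)"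

text \<open>Decoding is total, also on numbers that are not codes: 3 decodes to (2, 0), as does the
  code 6. Hence codes have to be compared by their components.\<close>

definition code_fst :: "nat \<Rightarrow> nat" where
  "code_fst z = z - isqrt z * isqrt z"

definition code_snd :: "nat \<Rightarrow> nat" where
  "code_snd z = isqrt z - code_fst z"

text \<open>The code lies between (a + b)^2 and (a + b)^2 + (a + b), which is less than (a + b +
  1)^2.\<close>

lemma isqrt_pair_code: "isqrt (pair_code a b) = a + b"
  unfolding isqrt_def
proof (rule Least_equality)
  show "Suc (pair_code a b) - Suc (a + b) * Suc (a + b) = 0"
    by (simp add: pair_code_def)
next
  fix s assume s: "Suc (pair_code a b) - Suc s * Suc s = 0"
  show "a + b \<le> s"
  proof (rule ccontr)
    assume "\<not> a + b \<le> s"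
    then have "Suc s \<le> a + b" by simp
    then have "Suc s * Suc s \<le> (a + b) * (a + b)" by (rule mult_le_mono) fact
    with s show False unfolding pair_code_def by linarith
  qed
qed

lemma code_fst_pair_code [simp]: "code_fst (pair_code a b) = a"
  unfolding code_fst_def isqrt_pair_code by (simp add: pair_code_def)

lemma code_snd_pair_code [simp]: "code_snd (pair_code a b) = b"
  unfolding code_snd_def isqrt_pair_code by simp

lemma recursive2_pair_code: "recursive2 A B pair_code"
  unfolding pair_code_def by (intro recursive_on_add recursive_on_mult recursive_on_proj) auto

lemma recursive1_isqrt: "recursive1 A isqrt"
  unfolding isqrt_def
proof (rule recursive1_Least)
  show "recursive2 UNIV A (\<lambda>s z. Suc z - Suc s * Suc s)"
    by (intro recursive_on_diff recursive_on_Suc recursive_on_mult recursive_on_proj) auto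
  \<comment> \<open>The search ends at \<open>s = z\<close> at the latest.\<close>
  have "Suc z - Suc z * Suc z = 0" for z by simp
  then show "\<exists>s. Suc z - Suc s * Suc s = 0" for z by blast
qed

lemma recursive1_code_fst: "recursive1 A code_fst"
  unfolding code_fst_def
  by (intro recursive_on_diff recursive_on_mult recursive1_isqrt recursive_on_proj) auto

lemma recursive1_code_snd: "recursive1 A code_snd"
  unfolding code_snd_def
  by (intro recursive_on_diff recursive1_code_fst recursive1_isqrt)

lemma recursive_on_code_fst: "recursive_on n A g \<Longrightarrow> recursive_on n A (\<lambda>xs. code_fst (g xs))"
  by (rule recursive1_comp[OF recursive1_code_fst]) auto

lemma recursive_on_code_snd: "recursive_on n A g \<Longrightarrow> recursive_on n A (\<lambda>xs. code_snd (g xs))"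
  by (rule recursive1_comp[OF recursive1_code_snd]) auto

section \<open>Indexings\<close>

lemma effectively_enumerable_iff:
  "effectively_enumerable A \<longleftrightarrow> A = {} \<or> (\<exists>F. recursive1 UNIV F \<and> range F = A)"
proof -
  have "(\<exists>f. partial_recursive 1 f \<and> (\<forall>x. f [x] \<noteq> None) \<and> A = range (\<lambda>x. the (f [x])))
    \<longleftrightarrow> (\<exists>F. recursive1 UNIV F \<and> range F = A)" (is "?L \<longleftrightarrow> ?R")
  proof
    assume ?L
    then obtain f where "partial_recursive 1 f" "\<forall>x. f [x] \<noteq> None" "A = range (\<lambda>x. the (f [x]))"
      by blast
    then have "recursive1 UNIV (\<lambda>x. the (f [x])) \<and> range (\<lambda>x. the (f [x])) = A"
      unfolding recursive_on_def listset1 by (auto intro!: exI[of _ f])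
    then show ?R by (intro exI[of _ "\<lambda>x. the (f [x])"])
  next
    assume ?R
    then obtain F p where "partial_recursive 1 p" "\<And>x. p [x] = Some (F x)" "range F = A"
      unfolding recursive_on_def listset1 by auto
    then show ?L by (intro exI[of _ p]) auto
  qed
  then show ?thesis unfolding effectively_enumerable_def by simp
qed

lemma indexing_iff:
  "indexing E i \<longleftrightarrow> ran i = E \<and> effectively_enumerable (dom i) \<and>
     recursive2 (dom i) (dom i) (\<lambda>x y. if i x = i y then 1 else 0)"
proof -
  have "(\<exists>e. computable_from_to 2 (listset [dom i, dom i]) {0, 1} e \<and>
        (\<forall>x\<in>dom i. \<forall>y\<in>dom i. e [x, y] = Some (if i x = i y then 1 else 0)))
    \<longleftrightarrow> recursive2 (dom i) (dom i) (\<lambda>x y. if i x = i y then 1 else 0)"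
    unfolding computable_from_to_def recursive_on_def
  proof (intro ex_cong1 iffI conjI ballI)
    fix e xs
    assume e: "(partial_recursive 2 e \<and> (\<forall>xs\<in>listset [dom i, dom i]. \<exists>y\<in>{0, 1}. e xs = Some y)) \<and>
      (\<forall>x\<in>dom i. \<forall>y\<in>dom i. e [x, y] = Some (if i x = i y then 1 else 0))"
    then show "partial_recursive 2 e" by (elim conjE)
    assume "xs \<in> listset [dom i, dom i]"
    then obtain x y where "xs = [x, y]" "x \<in> dom i" "y \<in> dom i" by (force simp: listset2)
    with e show "e xs = Some (if i (xs ! 0) = i (xs ! Suc 0) then 1 else 0)" by simp
  next
    fix e
    assume e: "partial_recursive 2 e \<and>
      (\<forall>xs\<in>listset [dom i, dom i]. e xs = Some (if i (xs ! 0) = i (xs ! Suc 0) then 1 else 0))"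
    then show "partial_recursive 2 e" by (elim conjE)
    show "\<exists>y\<in>{0, 1}. e xs = Some y" if "xs \<in> listset [dom i, dom i]" for xs
      using e that by simp
    show "e [x, y] = Some (if i x = i y then 1 else 0)" if "x \<in> dom i" "y \<in> dom i" for x y
      using e that by (force simp: listset2)
  qed
  then show ?thesis unfolding indexing_def by simp
qed

text \<open>Only binary operations occur in the two structures. That \<open>F\<close> takes values
  in \<open>dom j\<close> is expressed by \<open>j (F x y)\<close> being a
  \<open>Some\<close>.\<close>

lemma computable_rel_iff:
  "computable_rel [i, i'] j f \<longleftrightarrow>
    (\<exists>F. recursive2 (dom i) (dom i') F \<and>
      (\<forall>x\<in>dom i. \<forall>y\<in>dom i'. j (F x y) = Some (f [the (i x), the (i' y)])))" (is "?L \<longleftrightarrow> ?R")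
proof
  assume ?L
  then obtain p where p: "partial_recursive 2 p"
      "\<And>x y. x \<in> dom i \<Longrightarrow> y \<in> dom i' \<Longrightarrow> p [x, y] \<noteq> None"
      "\<And>x y. x \<in> dom i \<Longrightarrow> y \<in> dom i' \<Longrightarrow>
        (j \<circ>\<^sub>m p) [x, y] = Some (f [the (i x), the (i' y)])"
    unfolding computable_rel_def computable_from_to_def list.map listset2
    by (fastforce simp: numeral_2_eq_2)
  have "recursive2 (dom i) (dom i') (\<lambda>x y. the (p [x, y]))"
    unfolding recursive_on_def listset2
    by (intro exI[of _ p]) (auto simp: p(1,2) domIff)
  moreover have "j (the (p [x, y])) = Some (f [the (i x), the (i' y)])"
    if "x \<in> dom i" "y \<in> dom i'" for x y
    using p(2,3)[OF that] by (auto simp: map_comp_def split: option.splits)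
  ultimately show ?R by (intro exI[of _ "\<lambda>x y. the (p [x, y])"]) blast
next
  assume ?R
  then obtain F where F: "recursive2 (dom i) (dom i') F"
      "\<And>x y. x \<in> dom i \<Longrightarrow> y \<in> dom i' \<Longrightarrow> j (F x y) = Some (f [the (i x), the (i' y)])"
    by blast
  from F(1) obtain p where p: "partial_recursive 2 p"
      "\<And>xs. xs \<in> listset [dom i, dom i'] \<Longrightarrow> p xs = Some (F (xs ! 0) (xs ! Suc 0))"
    unfolding recursive_on_def by blast
  have "p [x, y] = Some (F x y)" if "x \<in> dom i" "y \<in> dom i'" for x y
    using p(2)[of "[x, y]"] that by (simp add: listset2)
  moreover have "F x y \<in> dom j" if "x \<in> dom i" "y \<in> dom i'" for x y
    using F(2)[OF that] by blast
  ultimately show ?L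
    unfolding computable_rel_def computable_from_to_def list.map listset2
    using p(1) F(2)
    by (intro exI[of _ p]) (auto simp: map_comp_def numeral_2_eq_2 domIff)
qed

text \<open>The relation in the definition of stability: \<open>H\<close> translates
  \<open>j'\<close>-indices into \<open>j\<close>-indices. It lands in \<open>dom j\<close> because
  \<open>j' x\<close> is not \<open>None\<close>.\<close>

definition reducible :: "(nat \<Rightarrow> 'u option) \<Rightarrow> (nat \<Rightarrow> 'u option) \<Rightarrow> bool" where
  "reducible j' j \<longleftrightarrow> (\<exists>H. recursive1 (dom j') H \<and> (\<forall>x\<in>dom j'. j' x = j (H x)))"

lemma reducible_iff:
  "reducible j' j \<longleftrightarrow>
    (\<exists>h. computable_from_to 1 (listset [dom j']) (dom j) h \<and> (\<forall>x\<in>dom j'. j' x = (j \<circ>\<^sub>m h) [x]))"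
    (is "_ \<longleftrightarrow> ?R")
proof
  assume "reducible j' j"
  then obtain H where H: "recursive1 (dom j') H" "\<And>x. x \<in> dom j' \<Longrightarrow> j' x = j (H x)"
    unfolding reducible_def by blast
  from H(1) obtain p where p: "partial_recursive 1 p"
      "\<And>xs. xs \<in> listset [dom j'] \<Longrightarrow> p xs = Some (H (xs ! 0))"
    unfolding recursive_on_def One_nat_def by blast
  have px: "p [x] = Some (H x)" if "x \<in> dom j'" for x
    using p(2)[of "[x]"] that by (simp add: listset1)
  have "H x \<in> dom j" if "x \<in> dom j'" for x
    using H(2)[OF that] that by (simp add: domIff)
  with px show ?R
    unfolding computable_from_to_def listset1
    using p(1) H(2) by (intro exI[of _ p]) (auto iff del: domIff)
next
  assume ?R
  then obtain p where p: "partial_recursive 1 p" "\<And>x. x \<in> dom j' \<Longrightarrow> p [x] \<noteq> None"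
      "\<And>x. x \<in> dom j' \<Longrightarrow> j' x = (j \<circ>\<^sub>m p) [x]"
    unfolding computable_from_to_def listset1 by fastforce
  then show "reducible j' j"
    unfolding reducible_def recursive_on_def listset1
    by (intro exI[of _ "\<lambda>x. the (p [x])"]) (force simp: map_comp_def split: option.splits)
qed

text \<open>Composition with an injection keeps the domain and the pairs of indices naming the same
  element. With \<open>Inl\<close> and \<open>Inr\<close> for \<open>f\<close>, it removes the tags
  of the two sorts.\<close>

lemma indexing_map_option_comp:
  assumes "inj f"
  shows "indexing (range f) (map_option f \<circ> i) \<longleftrightarrow> indexing UNIV i"
proof -
  have "dom (map_option f \<circ> i) = dom i" by (auto simp: dom_def)
  moreover have "ran (map_option f \<circ> i) = f ` ran i" by (auto simp: ran_def)
  moreover have "(map_option f \<circ> i) x = (map_option f \<circ> i) y \<longleftrightarrow> i x = i y" for x y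
    using injD[OF option.inj_map[OF assms]] by auto
  moreover have "f ` ran i = range f \<longleftrightarrow> ran i = UNIV"
    using inj_image_eq_iff[OF assms] by blast
  ultimately show ?thesis unfolding indexing_iff by presburger
qed

lemma factor_map_option:
  assumes "ran i \<subseteq> range f"
  obtains i' where "i = map_option f \<circ> i'"
proof -
  \<comment> \<open>A preimage is picked separately for each index, with \<open>None\<close> for
    \<open>None\<close>.\<close>
  have "\<exists>v. i x = map_option f v" for x
  proof (cases "i x")
    case (Some u)
    then have "u \<in> range f" using assms ranI by fastforce
    then show ?thesis using Some by (auto intro: exI[of _ "Some _"])
  qed (auto intro: exI[of _ None])
  then obtain v where "\<And>x. i x = map_option f (v x)" by metis
  then have "i = map_option f \<circ> v" by auto
  then show thesis by (rule that)
qed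

section \<open>Admissible indexings without lists and tags\<close>

abbreviation computable_binop ::
  "(nat \<Rightarrow> 'a option) \<Rightarrow> (nat \<Rightarrow> 'b option) \<Rightarrow> (nat \<Rightarrow> 'c option) \<Rightarrow> ('a \<Rightarrow> 'b \<Rightarrow> 'c) \<Rightarrow> bool" where
  "computable_binop i i' j f \<equiv> (\<exists>F. recursive2 (dom i) (dom i') F \<and>
      (\<forall>x\<in>dom i. \<forall>y\<in>dom i'. j (F x y) = Some (f (the (i x)) (the (i' y)))))"

definition field_indexing :: "(nat \<Rightarrow> 'k::field option) \<Rightarrow> bool" where
  "field_indexing i \<longleftrightarrow> indexing UNIV i \<and> computable_binop i i i (+) \<and> computable_binop i i i (*)"

definition vector_space_indexing ::
  "('k::field \<Rightarrow> 'e::ab_group_add \<Rightarrow> 'e) \<Rightarrow> (nat \<Rightarrow> 'k option) \<Rightarrow> (nat \<Rightarrow> 'e option) \<Rightarrow> bool" where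
  "vector_space_indexing scale i j \<longleftrightarrow>
     field_indexing i \<and> indexing UNIV j \<and> computable_binop j j j (+) \<and> computable_binop i j j scale"

lemma field_indexingD:
  assumes "field_indexing i"
  shows "indexing UNIV i" "computable_binop i i i (+)" "computable_binop i i i (*)"
  using assms[unfolded field_indexing_def] by - (elim conjE, assumption)+

lemma vector_space_indexingD:
  assumes "vector_space_indexing scale i j"
  shows "field_indexing i" "indexing UNIV j" "computable_binop j j j (+)"
    "computable_binop i j j scale"
  using assms[unfolded vector_space_indexing_def] by - (elim conjE, assumption)+

lemma admissible_indexing_field_structure:
  "admissible_indexing field_structure js \<longleftrightarrow> (\<exists>i. js = [i] \<and> field_indexing i)"
  unfolding admissible_indexing_def field_structure_def field_indexing_def
  by (auto simp: list_all2_Cons1 computable_rel_iff)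

lemma admissible_indexing_vector_space_structure:
  "admissible_indexing (vector_space_structure scale) js \<longleftrightarrow>
    (\<exists>i j. js = [map_option Inl \<circ> i, map_option Inr \<circ> j] \<and> vector_space_indexing scale i j)"
    (is "?L \<longleftrightarrow> ?R")
proof -
  \<comment> \<open>For indexings of tagged form, the tags cancel in each sort and each
    operation.\<close>
  have 1: "admissible_indexing (vector_space_structure scale)
      [map_option Inl \<circ> i, map_option Inr \<circ> j] \<longleftrightarrow> vector_space_indexing scale i j" for i j
  proof -
    have dom: "dom (map_option f \<circ> m) = dom m" for f :: "'x \<Rightarrow> 'y" and m :: "nat \<Rightarrow> 'x option"
      by (auto simp: dom_def)
    have inj: "inj (Inl :: 'a \<Rightarrow> 'a + 'b)" "inj (Inr :: 'b \<Rightarrow> 'a + 'b)" by simp_all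
    have the: "the (map_option f (m x)) = f (the (m x))" if "x \<in> dom m"
      for f :: "'x \<Rightarrow> 'y" and m :: "nat \<Rightarrow> 'x option" and x
      using that by auto
    show ?thesis
      unfolding admissible_indexing_def vector_space_structure_def vector_space_indexing_def
        field_indexing_def
      using indexing_map_option_comp[OF inj(1), of i] indexing_map_option_comp[OF inj(2), of j]
      by (simp add: computable_rel_iff dom the conj_ac cong: conj_cong ball_cong_simp)
  qed
  show ?thesis
  proof
    assume L: ?L
    \<comment> \<open>Every admissible indexing has tagged form, since the ranges of its two
      components are the two summands.\<close>
    then obtain i j where js: "js = [i, j]" "ran i = range Inl" "ran j = range Inr"
      unfolding admissible_indexing_def vector_space_structure_def indexing_def
      by (auto simp: list_all2_Cons1)
    obtain i' j' where "i = map_option Inl \<circ> i'" "j = map_option Inr \<circ> j'"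
      using js(2,3) factor_map_option by (metis order_refl)
    with L 1 js(1) show ?R by blast
  qed (use 1 in blast)
qed

lemma reducible_map_option_comp:
  assumes "inj f"
  shows "reducible (map_option f \<circ> i') (map_option f \<circ> i) \<longleftrightarrow> reducible i' i"
proof -
  have "dom (map_option f \<circ> i') = dom i'" by (auto simp: dom_def)
  moreover have "(map_option f \<circ> i') x = (map_option f \<circ> i) y \<longleftrightarrow> i' x = i y" for x y
    using injD[OF option.inj_map[OF assms]] by auto
  ultimately show ?thesis unfolding reducible_def by presburger
qed

lemma computability_stable_field_structure:
  "computability_stable (field_structure :: 'k::field many_sorted) \<longleftrightarrow>
    (\<exists>i :: nat \<Rightarrow> 'k option. field_indexing i) \<and>
    (\<forall>i i' :: nat \<Rightarrow> 'k option. field_indexing i \<longrightarrow> field_indexing i' \<longrightarrow> reducible i' i)"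
proof -
  have "length (sorts (field_structure :: 'k many_sorted)) = 1"
    by (simp add: field_structure_def)
  then show ?thesis
    unfolding computability_stable_def reducible_iff[symmetric] admissible_indexing_field_structure
    by (auto simp: imp_ex imp_conjL simp del: all_simps)
qed

lemma computability_stable_vector_space_structure:
  "computability_stable (vector_space_structure scale) \<longleftrightarrow>
    (\<exists>i j. vector_space_indexing scale i j) \<and>
    (\<forall>i j i' j'. vector_space_indexing scale i j \<longrightarrow> vector_space_indexing scale i' j' \<longrightarrow>
      reducible i' i \<and> reducible j' j)"
proof -
  have "length (sorts (vector_space_structure scale)) = Suc (Suc 0)"
    by (simp add: vector_space_structure_def)
  then show ?thesis
    unfolding computability_stable_def reducible_iff[symmetric]
      admissible_indexing_vector_space_structure
    by (auto simp: All_less_Suc2 reducible_map_option_comp imp_ex imp_conjL simp del: all_simps)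
qed

section \<open>Enumerating linear combinations\<close>

text \<open>\<open>z\<close> is read as nested pairs with one coefficient for each entry of
  \<open>bs\<close>; what is left after the last entry is ignored, so one vector has many
  codes.\<close>

fun lincomb_enum ::
  "('k \<Rightarrow> 'e \<Rightarrow> 'e::ab_group_add) \<Rightarrow> (nat \<Rightarrow> 'k) \<Rightarrow> 'e list \<Rightarrow> nat \<Rightarrow> 'e" where
  "lincomb_enum scale \<gamma> [] z = 0"
| "lincomb_enum scale \<gamma> (b # bs) z =
     scale (\<gamma> (code_fst z)) b + lincomb_enum scale \<gamma> bs (code_snd z)"

text \<open>The sequence \<open>s\<close> consists of elements, not of indices, so that one and the
  same \<open>s\<close> can be computable in two indexings and serve to compare them.\<close>

definition computable_seq :: "(nat \<Rightarrow> 'u option) \<Rightarrow> (nat \<Rightarrow> 'u) \<Rightarrow> bool" where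
  "computable_seq i s \<longleftrightarrow> (\<exists>C. recursive1 UNIV C \<and> (\<forall>n. i (C n) = Some (s n)))"

lemma indexing_enum:
  assumes "indexing (UNIV :: 'u set) i"
  obtains f s where "recursive1 UNIV f" "range f = dom i" "\<forall>n. i (f n) = Some (s n)" "surj s"
proof -
  \<comment> \<open>This excludes the empty case of effective enumerability; a total enumeration of
    the indices remains.\<close>
  have "dom i \<noteq> {}"
    using assms unfolding indexing_def by (auto simp: dom_eq_empty_conv)
  then obtain f where f: "recursive1 UNIV f" "range f = dom i"
    using assms unfolding indexing_def effectively_enumerable_iff by blast
  let ?s = "\<lambda>n. the (i (f n))"
  have *: "i (f n) = Some (?s n)" for n
  proof -
    have "f n \<in> dom i" using f(2) by blast
    then show ?thesis by auto
  qed
  have "\<exists>n. u = ?s n" for u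
  proof -
    obtain x where "i x = Some u"
      using assms unfolding indexing_def ran_def by blast
    moreover from this obtain n where "x = f n" using f(2) by blast
    ultimately show ?thesis by (metis option.sel)
  qed
  then have "surj ?s" unfolding surj_def by blast
  with f * show thesis by (intro that[of f ?s] allI)
qed

lemma computable_seq_reducible:
  assumes "computable_seq i' s" "reducible i' i"
  shows "computable_seq i s"
proof -
  obtain C where C: "recursive1 UNIV C" "\<And>n. i' (C n) = Some (s n)"
    using assms(1) unfolding computable_seq_def by blast
  obtain H where H: "recursive1 (dom i') H" "\<And>x. x \<in> dom i' \<Longrightarrow> i' x = i (H x)"
    using assms(2) unfolding reducible_def by blast
  have "recursive1 UNIV (\<lambda>n. H (C n))"
    using recursive1_comp[OF H(1) C(1)] C(2) by blast
  moreover have "i (H (C n)) = Some (s n)" for n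
    using H(2) C(2) by (metis domI)
  ultimately show ?thesis
    unfolding computable_seq_def by (intro exI[of _ "\<lambda>n. H (C n)"]) simp
qed

text \<open>Given \<open>x\<close>, the computable equality of \<open>i'\<close> allows searching for an \<open>n\<close> such that \<open>s n\<close> is the
  element with index \<open>x\<close>.\<close>

lemma reducible_if_common_seq:
  assumes i': "indexing (UNIV :: 'u set) i'" and s': "computable_seq i' s"
    and s: "computable_seq i s" and surj: "surj s"
  shows "reducible i' i"
proof -
  obtain C' where C': "recursive1 UNIV C'" "\<And>n. i' (C' n) = Some (s n)"
    using s' unfolding computable_seq_def by blast
  obtain C where C: "recursive1 UNIV C" "\<And>n. i (C n) = Some (s n)"
    using s unfolding computable_seq_def by blast
  let ?e = "\<lambda>x y. if i' x = i' y then 1 else 0"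
  \<comment> \<open>The equality test answers 1 on success, whereas the search looks for a
    0.\<close>
  let ?d = "\<lambda>z x. 1 - ?e (C' z) x :: nat"
  let ?Z = "\<lambda>x. LEAST z. ?d z x = 0"
  have e: "recursive2 (dom i') (dom i') ?e"
    using i' unfolding indexing_iff by blast
  have ex: "\<exists>z. ?d z x = 0" if x: "x \<in> dom i'" for x
  proof -
    obtain u where "i' x = Some u" using x by blast
    moreover obtain z where "u = s z" using surj by blast
    ultimately show ?thesis using C'(2) by (intro exI[of _ z]) simp
  qed
  have "recursive2 UNIV (dom i') (\<lambda>z x. ?e (C' z) x)"
    by (rule recursive2_comp[OF e recursive1_comp[OF C'(1)]])
      (use C'(2) in \<open>auto simp: listset2 intro: recursive_on_proj\<close>)
  then have "recursive2 UNIV (dom i') ?d"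
    by (intro recursive_on_diff recursive_on_const)
  then have "recursive1 (dom i') ?Z"
    using ex by (rule recursive1_Least)
  then have "recursive1 (dom i') (\<lambda>x. C (?Z x))"
    by (rule recursive1_comp[OF C(1)]) simp
  moreover have "i' x = i (C (?Z x))" if "x \<in> dom i'" for x
  proof -
    have "?d (?Z x) x = 0" by (rule LeastI_ex[OF ex[OF that]])
    then have "i' (C' (?Z x)) = i' x" by (simp split: if_splits)
    then show ?thesis using C(2) C'(2) by simp
  qed
  ultimately show ?thesis
    unfolding reducible_def by (intro exI[of _ "\<lambda>x. C (?Z x)"]) simp
qed

section \<open>Coordinates and their computability\<close>

context vector_space
begin

text \<open>Induction on \<open>bs\<close>: a vector lies in the span of \<open>b\<close> and
  \<open>S\<close> iff subtracting some multiple of \<open>b\<close> leads into the span of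
  \<open>S\<close>.\<close>

lemma range_lincomb_enum:
  assumes "surj \<gamma>"
  shows "range (lincomb_enum scale \<gamma> bs) = span (set bs)"
proof (induction bs)
  case Nil
  then show ?case by auto
next
  case (Cons b bs)
  show ?case
  proof (intro equalityI subsetI)
    fix v assume "v \<in> range (lincomb_enum scale \<gamma> (b # bs))"
    then obtain z where z: "v = lincomb_enum scale \<gamma> (b # bs) z" by blast
    have "lincomb_enum scale \<gamma> bs (code_snd z) \<in> span (set bs)"
      using Cons.IH by blast
    then show "v \<in> span (set (b # bs))"
      by (auto simp: z span_insert intro!: exI[of _ "\<gamma> (code_fst z)"])
  next
    fix v assume "v \<in> span (set (b # bs))"
    then obtain k where "v - scale k b \<in> span (set bs)"
      by (auto simp: span_insert)
    then obtain w where w: "v - scale k b = lincomb_enum scale \<gamma> bs w"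
      using Cons.IH by blast
    obtain a where a: "k = \<gamma> a" using assms by blast
    have "lincomb_enum scale \<gamma> (b # bs) (pair_code a w) = scale k b + (v - scale k b)"
      unfolding w by (simp add: a)
    then have "v = lincomb_enum scale \<gamma> (b # bs) (pair_code a w)" by simp
    then show "v \<in> range (lincomb_enum scale \<gamma> (b # bs))" by blast
  qed
qed

lemma lincomb_enum_in_span: "lincomb_enum scale \<gamma> bs z \<in> span (set bs)"
proof (induction bs arbitrary: z)
  case (Cons b bs)
  then show ?case
    by (auto simp: span_insert intro!: exI[of _ "\<gamma> (code_fst z)"])
qed (simp add: span_zero)

text \<open>Uniqueness of coordinates, one basis vector at a time: an equality gives (k - l) b = v -
  u, and dividing by a nonzero k - l would put \<open>b\<close> into the span.\<close>

lemma scale_add_eq_iff: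
  assumes "b \<notin> span S" "u \<in> span S" "v \<in> span S"
  shows "scale k b + u = scale l b + v \<longleftrightarrow> k = l \<and> u = v"
proof
  assume eq: "scale k b + u = scale l b + v"
  have "scale (k - l) b = v - u"
    using eq by (simp add: scale_left_diff_distrib algebra_simps)
  then have *: "scale (k - l) b \<in> span S"
    using assms(2,3) by (simp add: span_diff)
  have "k = l"
  proof (rule ccontr)
    assume "k \<noteq> l"
    then have "scale (inverse (k - l)) (scale (k - l) b) = b" by simp
    then show False using span_scale[OF *] assms(1) by metis
  qed
  with eq show "k = l \<and> u = v" by simp
qed simp

text \<open>The list \<open>bs\<close> is finite, so indices of its entries can be built into the
  program as constants; addition and scaling of indices are computable by admissibility.\<close>

lemma computable_seq_lincomb_enum:
  assumes ij: "vector_space_indexing scale i j" and \<gamma>: "computable_seq i \<gamma>"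
  shows "computable_seq j (lincomb_enum scale \<gamma> bs)"
proof (induction bs)
  case Nil
  obtain x where "j x = Some 0"
    using vector_space_indexingD(2)[OF ij] unfolding indexing_def ran_def by blast
  then show ?case
    unfolding computable_seq_def by (auto intro!: exI[of _ "\<lambda>_. x"] recursive_on_const)
next
  case (Cons b bs)
  \<comment> \<open>Some index of \<open>b\<close> exists by surjectivity, and any one will do as
    the constant.\<close>
  obtain x where x: "j x = Some b"
    using vector_space_indexingD(2)[OF ij] unfolding indexing_def ran_def by blast
  obtain P where P: "recursive2 (dom j) (dom j) P"
      "\<And>x y. x \<in> dom j \<Longrightarrow> y \<in> dom j \<Longrightarrow> j (P x y) = Some (the (j x) + the (j y))"
    using vector_space_indexingD(3)[OF ij] by blast
  obtain M where M: "recursive2 (dom i) (dom j) M"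
      "\<And>x y. x \<in> dom i \<Longrightarrow> y \<in> dom j \<Longrightarrow> j (M x y) = Some (scale (the (i x)) (the (j y)))"
    using vector_space_indexingD(4)[OF ij] by blast
  obtain G where G: "recursive1 UNIV G" "\<And>n. i (G n) = Some (\<gamma> n)"
    using \<gamma> unfolding computable_seq_def by blast
  obtain C where C: "recursive1 UNIV C" "\<And>n. j (C n) = Some (lincomb_enum scale \<gamma> bs n)"
    using Cons.IH unfolding computable_seq_def by blast
  have M': "j (M (G a) x) = Some (scale (\<gamma> a) b)" for a
    using M(2)[of "G a" x] G(2) x by (simp add: domIff)
  have "recursive1 UNIV (\<lambda>n. P (M (G (code_fst n)) x) (C (code_snd n)))"
    by (rule recursive2_comp[OF P(1)], rule recursive2_comp[OF M(1)])
      (use G C x M' in \<open>auto intro!: recursive1_comp[OF G(1)] recursive1_comp[OF C(1)]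
        recursive_on_const recursive_on_code_fst recursive_on_code_snd recursive_on_proj\<close>)
  moreover have "j (P (M (G (code_fst n)) x) (C (code_snd n))) =
      Some (lincomb_enum scale \<gamma> (b # bs) n)" for n
    using P(2)[of "M (G (code_fst n)) x" "C (code_snd n)"] M' C(2) by (simp add: domIff)
  ultimately show ?case
    unfolding computable_seq_def
    by (intro exI[of _ "\<lambda>n. P (M (G (code_fst n)) x) (C (code_snd n))"]) simp
qed

text \<open>One enumeration of the vectors, built from a sequence of scalars and a finite spanning
  set, is computable in both indexings.\<close>

lemma vector_space_indexing_reducible:
  assumes ij: "vector_space_indexing scale i j" and ij': "vector_space_indexing scale i' j'"
    and red: "reducible i' i" and B: "finite B" "span B = UNIV"
  shows "reducible j' j"
proof -
  from field_indexingD(1)[OF vector_space_indexingD(1)[OF ij']] obtain f \<gamma> where f: "recursive1 UNIV f" "\<forall>n. i' (f n) = Some (\<gamma> n)"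
      and \<gamma>: "surj \<gamma>"
    by (rule indexing_enum)
  have \<gamma>': "computable_seq i' \<gamma>"
    unfolding computable_seq_def using f by (intro exI[of _ f]) simp
  obtain bs where "set bs = B" using B(1) finite_list by blast
  then have "surj (lincomb_enum scale \<gamma> bs)"
    using range_lincomb_enum[OF \<gamma>] B(2) by simp
  moreover have "computable_seq j' (lincomb_enum scale \<gamma> bs)"
    by (rule computable_seq_lincomb_enum[OF ij' \<gamma>'])
  \<comment> \<open>Here the translation of scalar indices enters: \<open>\<gamma>\<close> was
    obtained from \<open>i'\<close>, and \<open>red\<close> makes it computable in
    \<open>i\<close>.\<close>
  moreover have "computable_seq j (lincomb_enum scale \<gamma> bs)"
    by (rule computable_seq_lincomb_enum[OF ij computable_seq_reducible[OF \<gamma>' red]])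
  ultimately show ?thesis
    using reducible_if_common_seq[OF vector_space_indexingD(2)[OF ij'], of "lincomb_enum scale \<gamma> bs"] by simp
qed

text \<open>Codes of linear combinations serve as indices of vectors: the span gives surjectivity,
  independence gives the equality test, and the operations act on coordinates.\<close>

lemma vector_space_indexing_exists:
  assumes i: "field_indexing i" and B: "finite B" "independent B" "span B = UNIV"
  shows "\<exists>j. vector_space_indexing scale i j"
proof -
  from field_indexingD(1)[OF i] obtain f \<gamma> where f: "recursive1 UNIV f" "range f = dom i" "\<forall>n. i (f n) = Some (\<gamma> n)"
      and \<gamma>: "surj \<gamma>"
    by (rule indexing_enum)
  have "dom i \<subseteq> range f" using f(2) by simp
  \<comment> \<open>Codes contain places in \<open>\<gamma>\<close>, while the operations of the
    field act on indices in \<open>dom i\<close>: \<open>f\<close> leads from places to indices and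
    \<open>g\<close> back.\<close>
  with f(1) obtain g where g: "recursive1 (dom i) g" "\<forall>x\<in>dom i. f (g x) = x"
    by (rule recursive1_right_inverse)
  have \<gamma>g: "\<gamma> (g x) = the (i x)" if "x \<in> dom i" for x
    using f(3)[rule_format, of "g x"] g(2) that by simp
  have f_dom: "f n \<in> dom i" for n using f(2) by blast
  let ?L = "lincomb_enum scale \<gamma>"
  have eqK: "recursive2 (dom i) (dom i) (\<lambda>x y. if i x = i y then 1 else 0)"
    using field_indexingD(1)[OF i] unfolding indexing_iff by blast
  obtain P where P: "recursive2 (dom i) (dom i) P"
      "\<And>x y. x \<in> dom i \<Longrightarrow> y \<in> dom i \<Longrightarrow> i (P x y) = Some (the (i x) + the (i y))"
    using field_indexingD(2)[OF i] by blast
  obtain M where M: "recursive2 (dom i) (dom i) M"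
      "\<And>x y. x \<in> dom i \<Longrightarrow> y \<in> dom i \<Longrightarrow> i (M x y) = Some (the (i x) * the (i y))"
    using field_indexingD(3)[OF i] by blast
  have P_dom: "P x y \<in> dom i" and M_dom: "M x y \<in> dom i" if "x \<in> dom i" "y \<in> dom i" for x y
    using P(2)[OF that] M(2)[OF that] by auto
  note f_comp = recursive1_comp[OF f(1)] and g_comp = recursive1_comp[OF g(1)]
  note rec_intros = recursive_on_code_fst recursive_on_code_snd recursive_on_proj
    f_comp g_comp recursive2_comp[OF P(1)] recursive2_comp[OF M(1)]

  have eqE: "recursive2 UNIV UNIV (\<lambda>z w. if ?L bs z = ?L bs w then 1 else 0)"
    if "distinct bs" "independent (set bs)" for bs
    using that
  proof (induction bs)
    case Nil
    then show ?case by (simp add: recursive_on_const)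
  next
    case (Cons b bs)
    then have b: "b \<notin> span (set bs)" and ind: "independent (set bs)"
      by (auto simp: independent_insert split: if_splits)
    have IH: "recursive2 UNIV UNIV (\<lambda>z w. if ?L bs z = ?L bs w then 1 else 0)"
      using Cons.IH Cons.prems(1) ind by simp
    \<comment> \<open>The product of two tests with values 0 and 1 is their conjunction: equal first
      coefficients and equal remainders.\<close>
    have "recursive2 UNIV UNIV (\<lambda>z w.
        (if i (f (code_fst z)) = i (f (code_fst w)) then 1 else 0) *
        (if ?L bs (code_snd z) = ?L bs (code_snd w) then 1 else 0))"
      by (rule recursive_on_mult, rule recursive2_comp[OF eqK])
        (auto simp: f_dom iff del: domIff intro!: recursive2_comp[OF IH] rec_intros)
    moreover have "?L (b # bs) z = ?L (b # bs) w \<longleftrightarrow>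
        i (f (code_fst z)) = i (f (code_fst w)) \<and> ?L bs (code_snd z) = ?L bs (code_snd w)" for z w
      by (simp add: f(3) scale_add_eq_iff[OF b lincomb_enum_in_span lincomb_enum_in_span])
    ultimately show ?case
      by (elim recursive_on_cong) (simp del: lincomb_enum.simps)
  qed

  have addE: "\<exists>A. recursive2 UNIV UNIV A \<and> (\<forall>z w. ?L bs (A z w) = ?L bs z + ?L bs w)" for bs
  proof (induction bs)
    case Nil
    \<comment> \<open>For the empty list every number codes the zero vector, so the constant 0
      serves.\<close>
    show ?case by (auto intro!: recursive_on_const[where c = 0] exI[of _ "\<lambda>_ _. 0"])
  next
    case (Cons b bs)
    then obtain A where A: "recursive2 UNIV UNIV A" "\<And>z w. ?L bs (A z w) = ?L bs z + ?L bs w"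
      by blast
    \<comment> \<open>The first coefficients are added as field indices, \<open>g\<close> turns the
      sum into a place, and \<open>A\<close> adds the remaining coordinates.\<close>
    let ?A = "\<lambda>z w. pair_code (g (P (f (code_fst z)) (f (code_fst w))))
      (A (code_snd z) (code_snd w))"
    have "recursive2 UNIV UNIV ?A"
      by (rule recursive2_comp[OF recursive2_pair_code[of UNIV UNIV]])
        (auto simp: f_dom P_dom iff del: domIff intro!: recursive2_comp[OF A(1)] rec_intros)
    moreover have "?L (b # bs) (?A z w) = ?L (b # bs) z + ?L (b # bs) w" for z w
      by (simp del: domIff add: \<gamma>g P_dom f_dom P(2) f(3) A(2) scale_left_distrib algebra_simps)
    ultimately show ?case by (intro exI[of _ ?A] conjI allI)
  qed

  have scaleE: "\<exists>S. recursive2 (dom i) UNIV S \<and>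
      (\<forall>x\<in>dom i. \<forall>z. ?L bs (S x z) = scale (the (i x)) (?L bs z))" for bs
  proof (induction bs)
    case Nil
    show ?case by (auto intro!: recursive_on_const[where c = 0] exI[of _ "\<lambda>_ _. 0"])
  next
    case (Cons b bs)
    then obtain S where S: "recursive2 (dom i) UNIV S"
        "\<And>x z. x \<in> dom i \<Longrightarrow> ?L bs (S x z) = scale (the (i x)) (?L bs z)"
      by blast
    \<comment> \<open>The scalar \<open>x\<close> is already a field index; only the coefficient in
      \<open>z\<close> has to pass through \<open>f\<close>.\<close>
    let ?S = "\<lambda>x z. pair_code (g (M x (f (code_fst z)))) (S x (code_snd z))"
    have "recursive2 (dom i) UNIV ?S"
      by (rule recursive2_comp[OF recursive2_pair_code[of UNIV UNIV]])
        (auto simp: f_dom M_dom listset2 iff del: domIff intro!: recursive2_comp[OF S(1)] rec_intros)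
    moreover have "?L (b # bs) (?S x z) = scale (the (i x)) (?L (b # bs) z)"
      if "x \<in> dom i" for x z
      using that by (simp del: domIff add: \<gamma>g M_dom f_dom M(2) f(3)[rule_format] S(2) scale_right_distrib)
    ultimately show ?case by (intro exI[of _ ?S] conjI ballI allI)
  qed

  obtain bs where bs: "set bs = B" "distinct bs" using B(1) finite_distinct_list by blast
  \<comment> \<open>Every number decodes to a combination, so \<open>j\<close> is total and its
    domain is trivially enumerable.\<close>
  define j where "j = (\<lambda>z. Some (?L bs z))"
  have dom_j: "dom j = UNIV" by (auto simp: j_def)
  have "ran j = range (?L bs)" by (auto simp: j_def ran_def)
  then have "ran j = UNIV" using range_lincomb_enum[OF \<gamma>] bs(1) B(3) by simp
  moreover have "effectively_enumerable (dom j)"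
    unfolding effectively_enumerable_iff dom_j
    by (intro disjI2 exI[of _ "\<lambda>x. x"]) (simp add: recursive_on_proj)
  moreover have "recursive2 (dom j) (dom j) (\<lambda>x y. if j x = j y then 1 else 0)"
    using eqE[OF bs(2)] bs(1) B(2) unfolding dom_j j_def option.inject by simp
  ultimately have "indexing UNIV j" unfolding indexing_iff by blast
  moreover have "computable_binop j j j (+)"
    using addE[of bs] unfolding dom_j j_def by simp
  moreover have "computable_binop i j j scale"
    using scaleE[of bs] unfolding dom_j j_def by simp
  ultimately have "vector_space_indexing scale i j"
    using i unfolding vector_space_indexing_def by (intro conjI)
  then show ?thesis by blast
qed

end

section \<open>Stability over the vector space\<close>

theorem proposition7:
  fixes scale :: "'k::field \<Rightarrow> 'e::ab_group_add \<Rightarrow> 'e"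
  assumes "vector_space scale"
    and "computability_stable (field_structure :: 'k many_sorted)"
    and "\<exists>B. finite_dimensional_vector_space scale B"
  shows "computability_stable (vector_space_structure scale)"
proof -
  obtain B where "finite_dimensional_vector_space scale B" using assms(3) by blast
  then interpret finite_dimensional_vector_space scale B .
  note B = finite_Basis independent_Basis span_Basis
  have exK: "\<exists>i :: nat \<Rightarrow> 'k option. field_indexing i"
    and redK: "\<And>i i' :: nat \<Rightarrow> 'k option.
      field_indexing i \<Longrightarrow> field_indexing i' \<Longrightarrow> reducible i' i"
    using assms(2) unfolding computability_stable_field_structure by blast+
  show ?thesis
    unfolding computability_stable_vector_space_structure
  proof (intro conjI allI impI)
    show "\<exists>i j. vector_space_indexing scale i j"
      using exK vector_space_indexing_exists[OF _ B] by blast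
  next
    fix i j i' j'
    assume ij: "vector_space_indexing scale i j" "vector_space_indexing scale i' j'"
    \<comment> \<open>The scalar parts are admissible indexings of the field, so stability over the
      field applies; its translation is then used for the vectors.\<close>
    then show red: "reducible i' i"
      by (intro redK vector_space_indexingD(1))
    show "reducible j' j"
      by (rule vector_space_indexing_reducible[OF ij red B(1,3)])
  qed
qed

end
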